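(* There exists a sequence of rational discrete probability distributions $P_2,P_3,\dots$ such that, for each $k\ge2$, the tree $\mathrm{FLDR}[P_k]$ has depth $k$ and the entropy tolls satisfy $6-\tau(\mathrm{FLDR}[P_k])=O(k2^{-k})$.
   Context: All logarithms are base 2; $H$ is Shannon entropy. For real $x\ge0$ and integer $d$, $\epsilon_d(x)=\lfloor2^dx\rfloor\bmod2$, $\nu(x)=\sum_dd\,\epsilon_d(x)2^{-d}$. A DDG tree is a sampler driven by i.i.d. fair bits: a binary tree (possibly with back edges to the root) with labeled leaves traversed from the root one fair bit per step until a leaf is reached; $C(T)$ is the number of bits consumed, $P_T$ the output distribution, and the toll is $\tau(T)=\mathbb{E}[C(T)]-H(P_T)$. FLDR: for positive integers $A_1,\dots,A_n$ with sum $M$, $K=\lceil\log M\rceil$, $A_0=2^K-M$, $Q=(A_0/2^K,\dots,A_n/2^K)$; $\mathrm{FLDR}[A_1,\dots,A_n]$ is an entropy-optimal DDG tree for $Q$ (exactly $\epsilon_d(A_i/2^K)$ leaves labeled $i$ at depth $d$; depth $K$) with every leaf labeled $0$ replaced by a back edge to the root; output distribution $(A_i/M)$, expected cost $(2^K/M)\sum_{i=0}^n\nu(A_i/2^K)$. For a rational distribution $P=(a_1/m,\dots,a_n/m)$ written with coprime positive integers $a_i$ and $m=\sum a_i$, $\mathrm{FLDR}[P]=\mathrm{FLDR}[a_1,\dots,a_n]$, whose depth is $\lceil\log m\rceil$. *)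

theory Defs
  imports "HOL-Probability.Probability" "HOL-Library.Landau_Symbols"
begin

(* Finite DDG trees. Back is an edge that returns to the root; it is not a node of the
   traversal and consumes no bit of its own. *)
datatype ddg = is_Leaf: Leaf (label: nat) | Back | Node ddg ddg

definition fair_bits :: "bool stream measure" where
  "fair_bits = stream_space (measure_pmf (bernoulli_pmf (1/2)))"

definition resolve :: "ddg \<Rightarrow> ddg \<Rightarrow> ddg" where
  "resolve R t = (if t = Back then R else t)"

(* One step of the traversal of the tree R from the current position. Leaves are absorbing. *)
fun step :: "ddg \<Rightarrow> bool \<Rightarrow> ddg \<Rightarrow> ddg" where
  "step R b (Node l r) = resolve R (if b then r else l)"
| "step R b (Leaf i) = Leaf i"
| "step R b Back = Back"

definition walk :: "ddg \<Rightarrow> bool stream \<Rightarrow> nat \<Rightarrow> ddg" where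
  "walk T \<omega> n = fold (step T) (stake n \<omega>) T"

(* C(T); the infimum of the empty set is infinity, which covers non-terminating runs. *)
definition bits_consumed :: "ddg \<Rightarrow> bool stream \<Rightarrow> enat" where
  "bits_consumed T \<omega> = (INF n \<in> {n. is_Leaf (walk T \<omega> n)}. enat n)"

definition sampler_output :: "ddg \<Rightarrow> bool stream \<Rightarrow> nat option" where
  "sampler_output T \<omega> =
     (case bits_consumed T \<omega> of enat n \<Rightarrow> Some (label (walk T \<omega> n)) | \<infinity> \<Rightarrow> None)"

(* An infinite expectation is mapped to 0; the toll is then at most 0, so it cannot be close to 6. *)
definition expected_cost :: "ddg \<Rightarrow> real" where
  "expected_cost T = enn2real (\<integral>\<^sup>+ \<omega>. ennreal_of_enat (bits_consumed T \<omega>) \<partial>fair_bits)"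

(* The library entropy of a random variable X is that of its distribution, here P_T. *)
definition output_entropy :: "ddg \<Rightarrow> real" where
  "output_entropy T =
     prob_space.entropy fair_bits 2
       (count_space (sampler_output T ` space fair_bits)) (sampler_output T)"

definition toll :: "ddg \<Rightarrow> real" where
  "toll T = expected_cost T - output_entropy T"

fun depth :: "ddg \<Rightarrow> nat" where
  "depth (Node l r) = Suc (max (depth l) (depth r))"
| "depth (Leaf i) = 0"
| "depth Back = 0"

fun leaf_count :: "ddg \<Rightarrow> nat \<Rightarrow> nat \<Rightarrow> nat" where
  "leaf_count (Leaf j) i d = (if j = i \<and> d = 0 then 1 else 0)"
| "leaf_count Back i d = 0"
| "leaf_count (Node l r) i d =
     (case d of 0 \<Rightarrow> 0 | Suc d' \<Rightarrow> leaf_count l i d' + leaf_count r i d')"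

fun back_free :: "ddg \<Rightarrow> bool" where
  "back_free (Leaf i) = True"
| "back_free Back = False"
| "back_free (Node l r) = (back_free l \<and> back_free r)"

definition binary_digit :: "int \<Rightarrow> real \<Rightarrow> int" where
  "binary_digit d x = \<lfloor>2 powi d * x\<rfloor> mod 2"

(* Entropy-optimal tree for the dyadic distribution Q on labels 0, ..., length Q - 1: the leaves
   labelled i at depth d are given by the d-th binary digit of Q_i. *)
definition optimal_ddg :: "real list \<Rightarrow> ddg \<Rightarrow> bool" where
  "optimal_ddg Q T \<longleftrightarrow> back_free T \<and>
     (\<forall>i d. int (leaf_count T i d) = (if i < length Q then binary_digit (int d) (Q ! i) else 0))"

fun reject_zero :: "ddg \<Rightarrow> ddg" where
  "reject_zero (Leaf i) = (if i = 0 then Back else Leaf i)"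
| "reject_zero Back = Back"
| "reject_zero (Node l r) = Node (reject_zero l) (reject_zero r)"

definition fldr_exponent :: "nat list \<Rightarrow> nat" where
  "fldr_exponent A = nat \<lceil>log 2 (real (sum_list A))\<rceil>"

definition fldr_proposal :: "nat list \<Rightarrow> real list" where
  "fldr_proposal A =
     (let K = fldr_exponent A
      in map (\<lambda>a. real a / 2 ^ K) ((2 ^ K - sum_list A) # A))"

(* The optimal tree, hence the FLDR tree, is unique only up to the arrangement of its leaves, so
   being an FLDR tree is a relation. *)
definition is_FLDR :: "nat list \<Rightarrow> ddg \<Rightarrow> bool" where
  "is_FLDR A T \<longleftrightarrow> A \<noteq> [] \<and> (\<forall>a \<in> set A. a > 0) \<and>
     (\<exists>U. optimal_ddg (fldr_proposal A) U \<and> T = reject_zero U)"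

definition rational_distribution :: "real list \<Rightarrow> bool" where
  "rational_distribution P \<longleftrightarrow> (\<forall>p \<in> set P. p \<in> \<rat> \<and> p > 0) \<and> sum_list P = 1"

definition is_FLDR_of :: "real list \<Rightarrow> ddg \<Rightarrow> bool" where
  "is_FLDR_of P T \<longleftrightarrow>
     (\<exists>a :: nat list. (\<forall>x \<in> set a. x > 0) \<and> Gcd (set a) = 1 \<and>
        P = map (\<lambda>x. real x / real (sum_list a)) a \<and> is_FLDR a T)"

end

theory Submission
  imports Defs
begin

text \<open>
  Take the weights \<open>(2^(k-1) - 1, 2)\<close>, whose sum exceeds \<open>2^(k-1)\<close> by only one, so that almost half
  of the probability mass is rejected. The rejection weight is again \<open>2^(k-1) - 1\<close>, and in binary
  these two numbers consist of ones only, which makes their leaves as deep as possible. With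
  \<open>y = 2^(1-k)\<close> one pass through the tree costs \<open>3 - 3 y\<close> bits on average and is accepted with
  probability \<open>(1 + y) / 2\<close>, so the expected cost is \<open>6 (1 - y) / (1 + y)\<close>, whereas the entropy of the
  output is only \<open>O(k y)\<close>.

  One-step analysis of the traversal expresses the cost and the output probabilities from any position
  affinely in those from the root. For the cost this equation is conclusive only once the
  expectation is known to be finite; this is obtained by bounding its partial sums by the
  solution of the equation.
\<close>

section \<open>Leaf statistics of a single pass\<close>

fun leaf_prob :: "nat \<Rightarrow> ddg \<Rightarrow> real" where
  "leaf_prob i (Leaf j) = (if j = i then 1 else 0)"
| "leaf_prob i Back = 0"
| "leaf_prob i (Node l r) = (leaf_prob i l + leaf_prob i r) / 2"

fun back_prob :: "ddg \<Rightarrow> real" where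
  "back_prob (Leaf j) = 0"
| "back_prob Back = 1"
| "back_prob (Node l r) = (back_prob l + back_prob r) / 2"

text \<open>\<open>Back\<close> also ends the pass at no cost, so this counts the bits of one pass
  whether it is accepted or rejected, and \<open>reject_zero\<close> leaves it unchanged.\<close>

fun mean_depth :: "ddg \<Rightarrow> real" where
  "mean_depth (Leaf j) = 0"
| "mean_depth Back = 0"
| "mean_depth (Node l r) = 1 + (mean_depth l + mean_depth r) / 2"

text \<open>Phrased through leaf counts because these are all that optimality prescribes.\<close>

definition has_label :: "ddg \<Rightarrow> nat \<Rightarrow> bool" where
  "has_label t i \<longleftrightarrow> (\<exists>d. leaf_count t i d > 0)"

lemma has_label_simps [simp]:
  "has_label (Leaf j) i \<longleftrightarrow> j = i"
  "has_label Back i \<longleftrightarrow> False"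
  "has_label (Node l r) i \<longleftrightarrow> has_label l i \<or> has_label r i"
proof -
  have "leaf_count (Node l r) i (Suc d) = leaf_count l i d + leaf_count r i d" for d by simp
  then show "has_label (Node l r) i \<longleftrightarrow> has_label l i \<or> has_label r i"
    unfolding has_label_def by (metis add_gr_0 less_irrefl leaf_count.simps(3) nat.case(1) not0_implies_Suc)
qed (auto simp: has_label_def)

lemma leaf_count_eq_0_beyond_depth: "depth t < d \<Longrightarrow> leaf_count t i d = 0"
  by (induction t arbitrary: d) (auto split: nat.splits)

text \<open>Without back edges a deepest path can only end in a leaf. This lets the depth be read
  off from the leaf counts.\<close>

lemma back_free_leaf_at_depth:
  "back_free t \<Longrightarrow> \<exists>i. leaf_count t i (depth t) > 0"
proof (induction t)
  case (Node l r)
  then obtain i j where "leaf_count l i (depth l) > 0" "leaf_count r j (depth r) > 0" by auto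
  then show ?case
    by (cases "depth l \<le> depth r") (auto simp: max_def)
qed auto

text \<open>A leaf at depth \<open>d\<close> is reached with probability \<open>1 / 2 ^ d\<close>.
  The bound \<open>N\<close> is free so that the induction can use one bound for two subtrees of
  different depth.\<close>

lemma leaf_prob_eq_sum:
  "depth t \<le> N \<Longrightarrow> leaf_prob i t = (\<Sum>d\<le>N. real (leaf_count t i d) / 2 ^ d)"
proof (induction t arbitrary: N)
  case (Leaf j)
  show ?case by (simp add: sum.atMost_shift)
next
  case (Node l r)
  then obtain N' where N': "N = Suc N'" by (cases N) auto
  with Node.prems have "depth l \<le> N'" "depth r \<le> N'" by auto
  note IH = Node.IH(1)[OF this(1)] Node.IH(2)[OF this(2)]
  show ?case unfolding N' leaf_prob.simps IH
    by (simp add: sum.atMost_Suc_shift sum.distrib sum_divide_distrib add_divide_distrib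
        mult.commute del: sum.atMost_Suc)
qed simp

lemma sum_leaf_prob:
  assumes "back_free t" "finite L" "\<And>i. has_label t i \<Longrightarrow> i \<in> L"
  shows "(\<Sum>i\<in>L. leaf_prob i t) = 1"
  using assms
  by (induction t) (auto simp: sum.delta sum.distrib simp flip: sum_divide_distrib)

lemma mean_depth_eq_sum:
  assumes "back_free t" "finite L" "\<And>i. has_label t i \<Longrightarrow> i \<in> L" "depth t \<le> N"
  shows "mean_depth t = (\<Sum>i\<in>L. \<Sum>d\<le>N. real d * real (leaf_count t i d) / 2 ^ d)"
  using assms
proof (induction t arbitrary: N)
  case (Leaf j)
  have "(\<Sum>d\<le>N. real d * real (leaf_count (Leaf j) i d) / 2 ^ d) = 0" for i
    by (intro sum.neutral) simp
  then show ?case by simp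
next
  case (Node l r)
  then obtain N' where N': "N = Suc N'" "depth l \<le> N'" "depth r \<le> N'" by (cases N) auto
  let ?m = "\<lambda>t i. \<Sum>d\<le>N'. real d * real (leaf_count t i d) / 2 ^ d"
  \<comment> \<open>Below a node each leaf moves one level down:
    \<open>(d + 1) / 2 ^ (d + 1)\<close> is half of \<open>d / 2 ^ d + 1 / 2 ^ d\<close>. The extra
    terms are the leaf probabilities, which sum to 1 in each subtree.\<close>
  have *: "(\<Sum>d\<le>N. real d * real (leaf_count (Node l r) i d) / 2 ^ d) =
     (?m l i + ?m r i + leaf_prob i l + leaf_prob i r) / 2" for i
    unfolding N'(1) leaf_prob_eq_sum[OF N'(2)] leaf_prob_eq_sum[OF N'(3)]
    by (simp add: sum.atMost_Suc_shift del: sum.atMost_Suc flip: sum.distrib)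
       (simp add: sum_distrib_left sum_distrib_right field_simps,
        intro sum.cong refl, simp add: field_simps)
  have "(\<Sum>i\<in>L. ?m l i) = mean_depth l" "(\<Sum>i\<in>L. ?m r i) = mean_depth r"
    using Node N' by auto
  moreover have "(\<Sum>i\<in>L. leaf_prob i l) = 1" "(\<Sum>i\<in>L. leaf_prob i r) = 1"
    using Node.prems by (auto intro!: sum_leaf_prob)
  ultimately show ?case
    unfolding * by (simp add: sum.distrib flip: sum_divide_distrib) 
qed simp

lemma depth_reject_zero [simp]: "depth (reject_zero t) = depth t"
  by (induction t) auto

lemma has_label_reject_zero [simp]: "has_label (reject_zero t) i \<longleftrightarrow> i \<noteq> 0 \<and> has_label t i"
  by (induction t) auto

lemma leaf_prob_reject_zero: "i \<noteq> 0 \<Longrightarrow> leaf_prob i (reject_zero t) = leaf_prob i t"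
  by (induction t) auto

lemma back_prob_reject_zero: "back_free t \<Longrightarrow> back_prob (reject_zero t) = leaf_prob 0 t"
  by (induction t) auto

lemma mean_depth_reject_zero [simp]: "mean_depth (reject_zero t) = mean_depth t"
  by (induction t) auto

section \<open>Runs of a sampler\<close>

text \<open>The walk from an arbitrary position \<open>t\<close>, with back edges leading to
  \<open>R\<close>. A step changes the position but not the root, so recursion on the first bit
  needs both parameters.\<close>

definition run :: "ddg \<Rightarrow> ddg \<Rightarrow> bool stream \<Rightarrow> nat \<Rightarrow> ddg" where
  "run R t \<omega> n = fold (step R) (stake n \<omega>) t"

lemma walk_eq_run: "walk T = run T T"
  by (simp add: walk_def run_def fun_eq_iff)

lemma run_simps [simp]:
  "run R t \<omega> 0 = t"
  "run R (Leaf i) \<omega> n = Leaf i"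
  "run R (Node l r) (b ## \<omega>) (Suc n) = run R (resolve R (if b then r else l)) \<omega> n"
proof -
  show "run R (Leaf i) \<omega> n = Leaf i"
    unfolding run_def by (induction n arbitrary: \<omega>) auto
qed (simp_all add: run_def)

lemma run_leaf_mono:
  assumes "run R t \<omega> n = Leaf i" "n \<le> m"
  shows "run R t \<omega> m = Leaf i"
proof -
  have "stake m \<omega> = stake n \<omega> @ stake (m - n) (sdrop n \<omega>)"
    using assms(2) by simp
  then have "run R t \<omega> m = run R (run R t \<omega> n) (sdrop n \<omega>) (m - n)"
    by (simp add: run_def del: stake_add)
  then show ?thesis by (simp add: assms(1))
qed

text \<open>A step leads into a subtree or back to \<open>T\<close>, so it never creates a label
  that \<open>T\<close> lacks.\<close>

lemma has_label_run:
  assumes "has_label (run T t \<omega> n) i" "\<And>i. has_label t i \<Longrightarrow> has_label T i"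
  shows "has_label T i"
  using assms
proof (induction n arbitrary: t \<omega>)
  case (Suc n)
  have "run T t \<omega> (Suc n) = run T (step T (shd \<omega>) t) (stl \<omega>) n"
    by (simp add: run_def)
  moreover have "has_label (step T (shd \<omega>) t) i \<Longrightarrow> has_label T i" for i
    using Suc.prems(2) by (cases t) (auto simp: resolve_def split: if_splits)
  ultimately show ?case using Suc by metis
qed auto

lemma bits_consumed_eq_infinity:
  "bits_consumed T \<omega> = \<infinity> \<longleftrightarrow> (\<forall>n. \<not> is_Leaf (walk T \<omega> n))"
  unfolding bits_consumed_def by (auto simp: INF_top_conv simp flip: top_enat_def) (simp add: top_enat_def)

lemma bits_consumed_eq_enatD:
  assumes "bits_consumed T \<omega> = enat n"
  shows "is_Leaf (walk T \<omega> m) \<longleftrightarrow> n \<le> m"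
proof -
  let ?N = "{n. is_Leaf (walk T \<omega> n)}"
  have ne: "?N \<noteq> {}" using assms bits_consumed_eq_infinity[of T \<omega>] by auto
  \<comment> \<open>\<open>enat\<close> is well-ordered, so the infimum of a nonempty set is
    attained.\<close>
  have "(INF n \<in> ?N. enat n) \<in> enat ` ?N" using ne by (blast intro: wellorder_InfI)
  then have n: "is_Leaf (walk T \<omega> n)" using assms by (auto simp: bits_consumed_def)
  have "n \<le> m" if "is_Leaf (walk T \<omega> m)"
    using INF_lower[of m ?N enat] that assms by (simp add: bits_consumed_def)
  moreover have "is_Leaf (walk T \<omega> m)" if "n \<le> m"
    using n that by (metis ddg.collapse(1) ddg.disc(1) run_leaf_mono walk_eq_run)
  ultimately show ?thesis by blast
qed

text \<open>Leaves are absorbing, so the first hitting time can be replaced by any time. The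
  right-hand side is directly measurable and suited to one-step analysis.\<close>

lemma sampler_output_eq_Some:
  "sampler_output T \<omega> = Some i \<longleftrightarrow> (\<exists>n. walk T \<omega> n = Leaf i)"
proof (cases "bits_consumed T \<omega>")
  case (enat n)
  note iff = bits_consumed_eq_enatD[OF enat]
  then obtain j where j: "walk T \<omega> n = Leaf j" by (metis ddg.collapse(1) order_refl)
  have "walk T \<omega> m = Leaf i \<Longrightarrow> i = j" for m
    using iff[of m] j run_leaf_mono[of T T \<omega> n j m] by (simp add: walk_eq_run)
  then show ?thesis using j by (auto simp: sampler_output_def enat)
next
  case infinity
  then show ?thesis using bits_consumed_eq_infinity[of T \<omega>]
    by (auto simp: sampler_output_def) (metis ddg.disc(1))
qed

text \<open>The pointwise tail-sum formula: each time at which the walk is not yet at a leaf costs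
  one bit.\<close>

lemma bits_consumed_eq_suminf:
  "ennreal_of_enat (bits_consumed T \<omega>) =
     (\<Sum>n. indicator {\<omega>. \<not> is_Leaf (walk T \<omega> n)} \<omega>)"
proof (cases "bits_consumed T \<omega>")
  case (enat n)
  have "(\<Sum>m. indicator {\<omega>. \<not> is_Leaf (walk T \<omega> m)} \<omega> :: ennreal) =
    (\<Sum>m<n. indicator {\<omega>. \<not> is_Leaf (walk T \<omega> m)} \<omega>)"
    using bits_consumed_eq_enatD[OF enat] by (intro suminf_finite) (auto simp: not_less)
  also have "\<dots> = (\<Sum>m<n. 1)"
    using bits_consumed_eq_enatD[OF enat] by (intro sum.cong) auto
  finally show ?thesis by (simp add: enat)
next
  case infinity
  then have "\<not> is_Leaf (walk T \<omega> m)" for m by (simp add: bits_consumed_eq_infinity)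
  then show ?thesis by (simp add: infinity suminf_eq_SUP ennreal_SUP_of_nat_eq_top)
qed

section \<open>Fair bits and conditioning on the first bit\<close>

interpretation fair: prob_space fair_bits
  unfolding fair_bits_def by (intro prob_space.prob_space_stream_space measure_pmf.prob_space_axioms)

lemma space_fair_bits [simp]: "space fair_bits = UNIV"
  by (simp add: fair_bits_def space_stream_space)

lemma measurable_run [measurable]: "(\<lambda>\<omega>. run R t \<omega> n) \<in> fair_bits \<rightarrow>\<^sub>M count_space UNIV"
proof -
  have "sets fair_bits = sets (stream_space (count_space UNIV))"
    unfolding fair_bits_def by (rule sets_stream_space_cong) simp
  then have [measurable]: "stake n \<in> fair_bits \<rightarrow>\<^sub>M count_space UNIV"
    using measurable_stake measurable_cong_sets by blast
  show ?thesis unfolding run_def by measurable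
qed

lemma measurable_is_Leaf_run [measurable]: "Measurable.pred fair_bits (\<lambda>\<omega>. is_Leaf (run R t \<omega> n))"
  using measurable_compose[OF measurable_run, of is_Leaf "count_space UNIV"] by simp

text \<open>The stream is one fair bit followed by an independent copy of itself.\<close>

lemma prob_fair_bits_split:
  assumes "A \<in> fair.events"
  shows "fair.prob A = (fair.prob {\<omega>. True ## \<omega> \<in> A} + fair.prob {\<omega>. False ## \<omega> \<in> A}) / 2"
proof -
  have "emeasure fair_bits A =
     emeasure fair_bits {\<omega>. True ## \<omega> \<in> A} * ennreal (1/2) +
     emeasure fair_bits {\<omega>. False ## \<omega> \<in> A} * ennreal (1/2)"
    using prob_space.emeasure_stream_space[OF measure_pmf.prob_space_axioms, of A "bernoulli_pmf (1/2)"] assms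
    by (simp add: fair_bits_def space_stream_space)
  also have "\<dots> = ennreal ((fair.prob {\<omega>. True ## \<omega> \<in> A} + fair.prob {\<omega>. False ## \<omega> \<in> A}) / 2)"
  proof -
    have "ennreal (x * (1/2) + z * (1/2)) = ennreal x * ennreal (1/2) + ennreal z * ennreal (1/2)"
      if "x \<ge> 0" "z \<ge> 0" for x z :: real
      using that by (subst ennreal_plus) (auto simp only: ennreal_mult'' mult_nonneg_nonneg
          zero_le_divide_1_iff zero_le_numeral)
    then show ?thesis by (simp add: fair.emeasure_eq_measure add_divide_distrib)
  qed
  finally show ?thesis by (simp add: fair.emeasure_eq_measure)
qed

section \<open>Output probabilities\<close>

definition hit_prob :: "ddg \<Rightarrow> nat \<Rightarrow> ddg \<Rightarrow> real" where
  "hit_prob R i t = fair.prob {\<omega>. \<exists>n. run R t \<omega> n = Leaf i}"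

text \<open>By the tail-sum formula, the sum over \<open>n\<close> will be the expected cost from
  position \<open>t\<close>.\<close>

definition alive_prob :: "ddg \<Rightarrow> ddg \<Rightarrow> nat \<Rightarrow> real" where
  "alive_prob R t n = fair.prob {\<omega>. \<not> is_Leaf (run R t \<omega> n)}"

lemma hit_prob_Leaf: "hit_prob R i (Leaf j) = (if j = i then 1 else 0)"
  using fair.prob_space by (auto simp: hit_prob_def)

lemma hit_prob_Node:
  "hit_prob R i (Node l r) = (hit_prob R i (resolve R l) + hit_prob R i (resolve R r)) / 2"
proof -
  let ?A = "{\<omega>. \<exists>n. run R (Node l r) \<omega> n = Leaf i}"
  have "?A = {\<omega> \<in> space fair_bits. \<exists>n. run R (Node l r) \<omega> n = Leaf i}" by simp
  also have "\<dots> \<in> fair.events" by measurable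
  finally have "?A \<in> fair.events" .
  note split = prob_fair_bits_split[OF this]
  have "(\<exists>n. run R (Node l r) (b ## \<omega>) n = Leaf i) \<longleftrightarrow>
        (\<exists>n. run R (resolve R (if b then r else l)) \<omega> n = Leaf i)" for b \<omega>
    by (metis ddg.distinct(3) not0_implies_Suc run_simps(1,3))
  from this[of True] this[of False] split show ?thesis
    by (simp add: hit_prob_def)
qed

text \<open>One pass either ends in a leaf or returns to the root, where the walk starts afresh. For
  \<open>t = T\<close> this becomes a linear equation for the value at the root.\<close>

lemma hit_prob_resolve:
  assumes "T \<noteq> Back"
  shows "hit_prob T i (resolve T t) = leaf_prob i t + back_prob t * hit_prob T i T"
proof (induction t)
  case (Node l r)
  then show ?case by (simp add: resolve_def[of T "Node l r"] hit_prob_Node field_simps)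
qed (auto simp: resolve_def hit_prob_Leaf)

lemma prob_sampler_output_Some:
  assumes "T \<noteq> Back" "back_prob T < 1"
  shows "fair.prob (sampler_output T -` {Some i}) = leaf_prob i T / (1 - back_prob T)"
proof -
  have "hit_prob T i T = leaf_prob i T + back_prob T * hit_prob T i T"
    using hit_prob_resolve[OF assms(1), of i T] assms(1) by (simp add: resolve_def)
  then have "hit_prob T i T = leaf_prob i T / (1 - back_prob T)"
    using assms(2) by (simp add: field_simps)
  then show ?thesis
    by (simp add: hit_prob_def vimage_def sampler_output_eq_Some walk_eq_run)
qed

section \<open>Expected cost\<close>

lemma alive_prob_nonneg: "0 \<le> alive_prob R t n"
  by (simp add: alive_prob_def)

lemma alive_prob_Leaf: "alive_prob R (Leaf i) n = 0"
  by (simp add: alive_prob_def)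

lemma alive_prob_0: "alive_prob R (Node l r) 0 = 1"
  using fair.prob_space by (simp add: alive_prob_def)

lemma alive_prob_Suc:
  "alive_prob R (Node l r) (Suc n) = (alive_prob R (resolve R l) n + alive_prob R (resolve R r) n) / 2"
proof -
  let ?A = "{\<omega>. \<not> is_Leaf (run R (Node l r) \<omega> (Suc n))}"
  have "?A = {\<omega> \<in> space fair_bits. \<not> is_Leaf (run R (Node l r) \<omega> (Suc n))}" by simp
  also have "\<dots> \<in> fair.events" by measurable
  finally have "?A \<in> fair.events" .
  from prob_fair_bits_split[OF this] show ?thesis
    by (simp add: alive_prob_def)
qed

lemma back_prob_nonneg: "0 \<le> back_prob t"
  by (induction t) auto

lemma mean_depth_nonneg: "0 \<le> mean_depth t"
  by (induction t) auto

text \<open>The a priori bound that makes the expectation finite. The induction is on the number of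
  steps and covers all positions at once.\<close>

lemma sum_alive_prob_le:
  assumes "T \<noteq> Back" "back_prob T < 1"
  shows "(\<Sum>n<N. alive_prob T (resolve T t) n)
    \<le> mean_depth t + back_prob t * (mean_depth T / (1 - back_prob T))"
proof (induction N arbitrary: t)
  case 0
  show ?case using assms(2) mean_depth_nonneg back_prob_nonneg by simp
next
  case (Suc N)
  \<comment> \<open>The candidate for the expected cost: the solution of
    \<open>c = mean_depth T + back_prob T * c\<close>.\<close>
  define c where "c = mean_depth T / (1 - back_prob T)"
  note IH = Suc[folded c_def]
  have node: "(\<Sum>n<Suc N. alive_prob T (Node l r) n)
      \<le> mean_depth (Node l r) + back_prob (Node l r) * c" for l r
  proof -
    have "(\<Sum>n<Suc N. alive_prob T (Node l r) n) =
      1 + ((\<Sum>n<N. alive_prob T (resolve T l) n) + (\<Sum>n<N. alive_prob T (resolve T r) n)) / 2"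
      by (simp add: sum.lessThan_Suc_shift alive_prob_0 alive_prob_Suc sum.distrib
          flip: sum_divide_distrib del: sum.lessThan_Suc)
    also have "\<dots> \<le> 1 + ((mean_depth l + back_prob l * c) + (mean_depth r + back_prob r * c)) / 2"
      using IH[of l] IH[of r] by (intro add_left_mono divide_right_mono add_mono) auto
    also have "\<dots> = mean_depth (Node l r) + back_prob (Node l r) * c"
      by (simp add: field_simps)
    finally show ?thesis .
  qed
  \<comment> \<open>A back edge consumes no bit, so resolving it does not decrease
    \<open>Suc N\<close>. The other positions are therefore settled first, and \<open>Back\<close>
    is then treated as the root \<open>T\<close>.\<close>
  have nonback: "(\<Sum>n<Suc N. alive_prob T t n) \<le> mean_depth t + back_prob t * c"
    if "t \<noteq> Back" for t
    using that node by (cases t) (auto simp: alive_prob_Leaf simp del: sum.lessThan_Suc)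
  have "mean_depth T + back_prob T * c = c"
    using assms(2) by (simp add: c_def field_simps)
  with nonback[OF assms(1)] nonback[of t] show ?case unfolding c_def[symmetric]
    by (cases "t = Back") (auto simp: resolve_def)
qed

lemma summable_alive_prob:
  assumes "T \<noteq> Back" "back_prob T < 1"
  shows "summable (alive_prob T (resolve T t))"
  by (rule summableI_nonneg_bounded[OF _ sum_alive_prob_le[OF assms]]) (rule alive_prob_nonneg)

text \<open>Summability allows the one-step equation to be summed over all times, which turns the
  bound into an identity.\<close>

lemma suminf_alive_prob:
  assumes "T \<noteq> Back" "back_prob T < 1"
  shows "(\<Sum>n. alive_prob T (resolve T t) n) =
    mean_depth t + back_prob t * (\<Sum>n. alive_prob T T n)"
proof (induction t)
  case (Node l r)
  let ?E = "\<lambda>t. \<Sum>n. alive_prob T (resolve T t) n"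
  note sm = summable_alive_prob[OF assms]
  have "?E (Node l r) = (\<Sum>n. alive_prob T (Node l r) (Suc n)) + 1"
    using suminf_split_head[OF sm[of "Node l r"]] by (simp add: resolve_def alive_prob_0)
  also have "\<dots> = (?E l + ?E r) / 2 + 1"
    by (simp add: alive_prob_Suc suminf_divide summable_add sm suminf_add)
  finally show ?case using Node by (simp add: field_simps)
qed (auto simp: resolve_def alive_prob_Leaf)

lemma expected_cost_eq:
  assumes "T \<noteq> Back" "back_prob T < 1"
  shows "expected_cost T = mean_depth T / (1 - back_prob T)"
proof -
  have [simp]: "resolve T T = T" using assms(1) by (simp add: resolve_def)
  let ?A = "\<lambda>n. {\<omega>. \<not> is_Leaf (walk T \<omega> n)}"
  have ev: "?A n \<in> fair.events" for n
  proof -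
    have "?A n = {\<omega> \<in> space fair_bits. \<not> is_Leaf (run T T \<omega> n)}" by (simp add: walk_eq_run)
    also have "\<dots> \<in> fair.events" by measurable
    finally show ?thesis .
  qed
  have "(\<integral>\<^sup>+ \<omega>. ennreal_of_enat (bits_consumed T \<omega>) \<partial>fair_bits) =
     (\<Sum>n. \<integral>\<^sup>+ \<omega>. indicator (?A n) \<omega> \<partial>fair_bits)"
    unfolding bits_consumed_eq_suminf using ev by (intro nn_integral_suminf) auto
  also have "\<dots> = (\<Sum>n. ennreal (alive_prob T T n))"
    using ev by (simp add: fair.emeasure_eq_measure alive_prob_def walk_eq_run)
  also have "\<dots> = ennreal (\<Sum>n. alive_prob T T n)"
    using summable_alive_prob[OF assms, of T]
    by (intro suminf_ennreal2) (auto simp: alive_prob_nonneg)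
  \<comment> \<open>The integral is now known to be finite, so \<open>enn2real\<close> returns its
    true value.\<close>
  finally have "expected_cost T = (\<Sum>n. alive_prob T T n)"
    using suminf_nonneg[OF summable_alive_prob[OF assms, of T]]
    by (simp add: expected_cost_def alive_prob_nonneg)
  moreover have "(\<Sum>n. alive_prob T T n) = mean_depth T + back_prob T * (\<Sum>n. alive_prob T T n)"
    using suminf_alive_prob[OF assms, of T] by simp
  ultimately show ?thesis using assms(2) by (simp add: field_simps)
qed

section \<open>Entropy of the output\<close>

lemma output_entropy_eq:
  assumes "T \<noteq> Back" "back_prob T < 1" "finite L" "\<And>i. has_label T i \<Longrightarrow> i \<in> L"
    and total: "(\<Sum>i\<in>L. leaf_prob i T) = 1 - back_prob T"
  shows "output_entropy T =
    - (\<Sum>i\<in>L. let p = leaf_prob i T / (1 - back_prob T) in p * log 2 p)"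
proof -
  interpret information_space fair_bits 2 by standard simp
  let ?X = "sampler_output T"
  let ?P = "\<lambda>x. fair.prob (?X -` {x})"
  let ?S = "insert None (Some ` L)"
  have sub: "range ?X \<subseteq> ?S"
  proof (clarify)
    fix \<omega> assume "?X \<omega> \<notin> Some ` L"
    moreover have "?X \<omega> = Some i \<Longrightarrow> i \<in> L" for i
      using has_label_run[of T T \<omega> _ i] assms(4)
      by (metis has_label_simps(1) sampler_output_eq_Some walk_eq_run)
    ultimately show "?X \<omega> = None" by (cases "?X \<omega>") auto
  qed
  have fin: "finite (range ?X)" using sub assms(3) by (meson finite.insertI finite_imageI finite_subset)
  have ev_Some: "?X -` {Some i} \<in> fair.events" for i
  proof -
    have "?X -` {Some i} = {\<omega> \<in> space fair_bits. \<exists>n. run T T \<omega> n = Leaf i}"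
      by (auto simp: sampler_output_eq_Some walk_eq_run)
    also have "\<dots> \<in> fair.events" by measurable
    finally show ?thesis .
  qed
  have None_eq: "?X -` {None} = space fair_bits - (\<Union>i\<in>L. ?X -` {Some i})"
    using sub by auto
  have ev: "?X -` {x} \<in> fair.events" for x
  proof (cases x)
    case None
    have "(\<Union>i\<in>L. ?X -` {Some i}) \<in> fair.events" using ev_Some assms(3) by blast
    then show ?thesis unfolding None None_eq by (rule sets.compl_sets)
  qed (simp add: ev_Some)
  have sf: "simple_function fair_bits ?X"
    unfolding simple_function_def using fin ev by auto
  have P_Some: "?P (Some i) = leaf_prob i T / (1 - back_prob T)" for i
    using prob_sampler_output_Some[OF assms(1,2)] .
  have "fair.prob (\<Union>i\<in>L. ?X -` {Some i}) = (\<Sum>i\<in>L. ?P (Some i))"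
    using assms(3) ev_Some
    by (intro fair.finite_measure_finite_Union) (auto simp: disjoint_family_on_def)
  also have "\<dots> = 1" using total assms(2) by (simp add: P_Some flip: sum_divide_distrib)
  \<comment> \<open>The label probabilities exhaust the total mass, so non-termination is a null
    event.\<close>
  finally have P_None: "?P None = 0"
    unfolding None_eq using assms(3) ev_Some by (subst fair.prob_compl) auto
  have "simple_distributed fair_bits ?X ?P"
    using sf by (intro fair.simple_distributedI) auto
  then have "output_entropy T = - (\<Sum>x\<in>range ?X. ?P x * log 2 (?P x))"
    unfolding output_entropy_def using entropy_simple_distributed by simp
  \<comment> \<open>The sum may be extended to values that never occur: their preimage is empty and
    their term is 0 whatever \<open>log 2 0\<close> is.\<close>
  also have "(\<Sum>x\<in>range ?X. ?P x * log 2 (?P x)) = (\<Sum>x\<in>?S. ?P x * log 2 (?P x))"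
  proof (rule sum.mono_neutral_left)
    show "\<forall>x\<in>?S - range ?X. ?P x * log 2 (?P x) = 0"
    proof
      fix x assume "x \<in> ?S - range ?X"
      then have "?X -` {x} = {}" by auto
      then show "?P x * log 2 (?P x) = 0" by simp
    qed
  qed (use sub assms(3) in auto)
  also have "\<dots> = (\<Sum>i\<in>L. ?P (Some i) * log 2 (?P (Some i)))"
    using assms(3) P_None by (subst sum.insert) (auto simp: sum.reindex)
  finally show ?thesis by (simp add: P_Some Let_def)
qed

section \<open>Binary digits of dyadic rationals\<close>

lemma binary_digit_dyadic:
  "binary_digit (int d) (real a / 2 ^ k) = of_bool (d \<le> k \<and> bit a (k - d))"
proof -
  have "2 powi int d * (real a / 2 ^ k) = real (a * 2 ^ d) / real (2 ^ k)"
    by (simp add: power_int_def)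
  then have "binary_digit (int d) (real a / 2 ^ k) = int (a * 2 ^ d div 2 ^ k mod 2)"
    unfolding binary_digit_def by (simp only: floor_divide_of_nat_eq zmod_int of_nat_numeral)
  moreover have "a * 2 ^ d div 2 ^ k = a div 2 ^ (k - d)" if "d \<le> k"
  proof -
    have "(2::nat) ^ k = 2 ^ (k - d) * 2 ^ d" using that by (simp flip: power_add)
    then show ?thesis by simp
  qed
  \<comment> \<open>All digits beyond position \<open>k\<close> vanish. The guard
    \<open>d \<le> k\<close> is essential, since truncated subtraction would give
    \<open>k - d = 0\<close> and select the lowest bit of \<open>a\<close>.\<close>
  moreover have "even (a * 2 ^ d div 2 ^ k)" if "\<not> d \<le> k"
  proof -
    have "(2::nat) ^ d = 2 ^ (d - k) * 2 ^ k" using that by (simp flip: power_add)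
    then have "a * 2 ^ d div 2 ^ k = a * 2 ^ (d - k)" by simp
    then show ?thesis using that by simp
  qed
  ultimately show ?thesis
    by (cases "d \<le> k") (auto simp: bit_iff_odd odd_iff_mod_2_eq_one)
qed

section \<open>The extremal distributions\<close>

definition extremal_weights :: "nat \<Rightarrow> nat list" where
  "extremal_weights k = [2 ^ (k - 1) - 1, 2]"

text \<open>Bit \<open>b\<close> of a weight yields a leaf at depth \<open>k - b\<close>. The
  weights of labels 0 and 1 have exactly the bits 0 to \<open>k - 2\<close>, and the weight 2 has
  only bit 1.\<close>

definition extremal_leaf_count :: "nat \<Rightarrow> nat \<Rightarrow> nat \<Rightarrow> nat" where
  "extremal_leaf_count k i d =
     (if i < 2 then of_bool (2 \<le> d \<and> d \<le> k) else of_bool (i = 2 \<and> Suc d = k))"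

lemma sum_extremal_weights: "sum_list (extremal_weights k) = 2 ^ (k - 1) + 1"
proof -
  have "(1::nat) \<le> 2 ^ (k - 1)" by simp
  then show ?thesis unfolding extremal_weights_def by simp
qed

lemma fldr_exponent_extremal_weights:
  assumes "k \<ge> 2"
  shows "fldr_exponent (extremal_weights k) = k"
proof -
  obtain m where k: "k = Suc m" using assms by (cases k) auto
  have "log 2 (2 ^ m + 1 :: real) > log 2 (2 ^ m)"
    by (subst log_less_cancel_iff) (auto simp: add_pos_pos)
  moreover have "log 2 (2 ^ m + 1 :: real) \<le> real (Suc m)"
    by (subst log_le_iff) (auto simp: powr_realpow add_pos_pos simp del: of_nat_Suc)
  ultimately have "\<lceil>log 2 (2 ^ m + 1 :: real)\<rceil> = int k"
    unfolding k by (intro ceiling_unique) auto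
  then show ?thesis
    unfolding fldr_exponent_def sum_extremal_weights by (simp add: k add.commute)
qed

text \<open>Rejection weight and first weight agree, as
  \<open>2 ^ k - (2 ^ (k - 1) + 1) = 2 ^ (k - 1) - 1\<close>. Writing them as \<open>mask\<close>
  exposes their bits.\<close>

lemma fldr_proposal_extremal_weights:
  assumes "k \<ge> 2"
  shows "fldr_proposal (extremal_weights k) =
    map (\<lambda>a. real a / 2 ^ k) [mask (k - 1), mask (k - 1), 2]"
proof -
  obtain m where k: "k = Suc m" using assms by (cases k) auto
  have "2 ^ k - sum_list (extremal_weights k) = mask (k - 1)"
    by (simp add: sum_extremal_weights mask_eq_exp_minus_1 k)
  then show ?thesis
    unfolding fldr_proposal_def fldr_exponent_extremal_weights[OF assms]
    by (simp add: extremal_weights_def mask_eq_exp_minus_1)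
qed

lemma optimal_ddg_extremal_iff:
  assumes "k \<ge> 2"
  shows "optimal_ddg (fldr_proposal (extremal_weights k)) U \<longleftrightarrow>
    back_free U \<and> (\<forall>i d. leaf_count U i d = extremal_leaf_count k i d)"
proof -
  let ?Q = "fldr_proposal (extremal_weights k)"
  have "(if i < length ?Q then binary_digit (int d) (?Q ! i) else 0) = int (extremal_leaf_count k i d)"
    for i d
  proof -
    have "i < 2 \<or> i = 2 \<or> i > 2" by auto
    moreover have "binary_digit (int d) (?Q ! i) = of_bool (d \<le> k \<and> bit (mask (k - 1) :: nat) (k - d))"
      if "i < 2"
      using that binary_digit_dyadic[of d "mask (k - 1)" k]
      by (auto simp: fldr_proposal_extremal_weights[OF assms] less_2_cases_iff)
    moreover have "bit (mask (k - 1) :: nat) (k - d) \<longleftrightarrow> k - d < k - 1"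
      by (simp add: bit_mask_iff)
    moreover have "bit (2::nat) (k - d) \<longleftrightarrow> k - d = 1" by (auto simp: bit_2_iff)
    moreover have "binary_digit (int d) (?Q ! 2) = of_bool (d \<le> k \<and> bit (2 :: nat) (k - d))"
      using binary_digit_dyadic[of d 2 k] by (simp add: fldr_proposal_extremal_weights[OF assms])
    moreover have "length ?Q = 3" by (simp add: fldr_proposal_extremal_weights[OF assms])
    ultimately show ?thesis using assms
      by (auto simp: extremal_leaf_count_def)
  qed
  then show ?thesis by (simp add: optimal_ddg_def)
qed

section \<open>Existence of an optimal tree\<close>

fun spine :: "nat \<Rightarrow> nat \<Rightarrow> ddg \<Rightarrow> ddg" where
  "spine j 0 t = t"
| "spine j (Suc n) t = Node (Leaf j) (spine j n t)"

lemma back_free_spine [simp]: "back_free (spine j n t) = back_free t"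
  by (induction n) auto

lemma leaf_count_spine:
  "leaf_count (spine j n t) i d =
     of_bool (j = i \<and> 1 \<le> d \<and> d \<le> n) + (if n \<le> d then leaf_count t i (d - n) else 0)"
  by (induction n arbitrary: d) (auto split: nat.splits)

lemma ex_optimal_ddg_extremal:
  assumes "k \<ge> 2"
  shows "\<exists>U. optimal_ddg (fldr_proposal (extremal_weights k)) U"
proof -
  obtain m where k: "k = Suc (Suc m)"
    using assms by (metis Suc_le_D numeral_2_eq_2 Suc_le_mono)
  \<comment> \<open>The spines supply labels 0 and 1 at depths 2 to \<open>k - 1\<close>. The node
    ending the first spine adds one leaf of each at depth \<open>k\<close>, and label 2 ends the
    second spine at depth \<open>k - 1\<close>.\<close>
  let ?U = "Node (spine 0 m (Node (Leaf 0) (Leaf 1))) (spine 1 m (Leaf 2))"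
  have "leaf_count ?U i d = extremal_leaf_count k i d" for i d
    by (auto simp: leaf_count_spine extremal_leaf_count_def k split: nat.splits)
  then show ?thesis
    using assms by (intro exI[of _ ?U]) (simp add: optimal_ddg_extremal_iff)
qed

section \<open>The distributions and their reduced weights\<close>

definition extremal_dist :: "nat \<Rightarrow> real list" where
  "extremal_dist k = map (\<lambda>x. real x / real (sum_list (extremal_weights k))) (extremal_weights k)"

lemma extremal_weights_pos: "k \<ge> 2 \<Longrightarrow> x \<in> set (extremal_weights k) \<Longrightarrow> x > 0"
  using power_strict_increasing[of 0 "k - 1" "2::nat"] by (auto simp: extremal_weights_def)

lemma coprime_extremal_weights:
  assumes "k \<ge> 2"
  shows "coprime (2 ^ (k - 1) - 1) (2::nat)"
  using assms by (cases k) auto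

lemma rational_distribution_extremal:
  assumes "k \<ge> 2"
  shows "rational_distribution (extremal_dist k)"
proof -
  let ?s = "real (sum_list (extremal_weights k))"
  have s: "?s > 0" unfolding sum_extremal_weights by (simp add: add_pos_pos)
  have "p \<in> \<rat> \<and> p > 0" if "p \<in> set (extremal_dist k)" for p
    using that extremal_weights_pos[OF assms] s by (auto simp: extremal_dist_def)
  moreover have "sum_list (extremal_dist k) = 1"
  proof -
    have "sum_list (map (\<lambda>x. real x / c) xs) = real (sum_list xs) / c" for c xs
      by (induction xs) (auto simp: add_divide_distrib)
    then have "sum_list (extremal_dist k) = ?s / ?s" unfolding extremal_dist_def .
    also have "\<dots> = 1" using s by (intro divide_self) linarith
    finally show ?thesis .
  qed
  ultimately show ?thesis by (simp add: rational_distribution_def)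
qed

text \<open>\<open>is_FLDR_of\<close> quantifies over coprime weight lists. Such a list is
  determined by the distribution, so only the extremal weights qualify.\<close>

lemma is_FLDR_of_extremal_iff:
  assumes "k \<ge> 2"
  shows "is_FLDR_of (extremal_dist k) T \<longleftrightarrow> is_FLDR (extremal_weights k) T"
proof
  assume "is_FLDR (extremal_weights k) T"
  moreover have "Gcd (set (extremal_weights k)) = 1"
    using coprime_extremal_weights[OF assms] by (simp add: extremal_weights_def coprime_iff_gcd_eq_1)
  ultimately show "is_FLDR_of (extremal_dist k) T"
    unfolding is_FLDR_of_def using extremal_weights_pos[OF assms]
    by (intro exI[of _ "extremal_weights k"]) (simp add: extremal_dist_def)
next
  assume "is_FLDR_of (extremal_dist k) T"
  then obtain a where a: "\<forall>x \<in> set a. x > 0" "Gcd (set a) = 1"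
    "extremal_dist k = map (\<lambda>x. real x / real (sum_list a)) a" "is_FLDR a T"
    unfolding is_FLDR_of_def by blast
  define u :: nat where "u = 2 ^ (k - 1) - 1"
  have w: "extremal_weights k = [u, 2]" by (simp add: extremal_weights_def u_def)
  have "length a = 2" using arg_cong[OF a(3), of length] by (simp add: extremal_dist_def w)
  then obtain x y where xy: "a = [x, y]"
    by (auto simp: numeral_2_eq_2 length_Suc_conv)
  have pos: "x > 0" "y > 0" "u > 0"
    using a(1) extremal_weights_pos[OF assms] by (auto simp: xy w)
  have "real u / (real u + 2) = real x / (real x + real y)"
    using a(3) by (simp add: extremal_dist_def w xy add.commute)
  then have "real u * (real x + real y) = real x * (real u + 2)"
    using pos by (simp add: frac_eq_eq add_pos_pos add_nonneg_eq_0_iff)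
  then have "real (u * y) = real (x * 2)" by (simp add: algebra_simps)
  then have eq: "u * y = x * 2" by (simp only: of_nat_eq_iff)
  have cop: "coprime u 2" "coprime x y"
    using coprime_extremal_weights[OF assms] a(2) by (auto simp: u_def xy coprime_iff_gcd_eq_1)
  \<comment> \<open>In \<open>u * y = x * 2\<close>, coprimality of \<open>u\<close> and 2 and of
    \<open>x\<close> and \<open>y\<close> makes \<open>u\<close> and \<open>x\<close> divide each
    other.\<close>
  have "u dvd x" using eq cop(1) by (metis coprime_dvd_mult_left_iff dvd_triv_left)
  moreover have "x dvd u" using eq cop(2) by (metis coprime_dvd_mult_left_iff dvd_triv_left)
  ultimately have "x = u" by (simp add: dvd_antisym)
  with eq pos have "y = 2" by simp
  with \<open>x = u\<close> a(4) show "is_FLDR (extremal_weights k) T" by (simp add: w xy)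
qed

lemma is_FLDR_extremal_iff:
  assumes "k \<ge> 2"
  shows "is_FLDR (extremal_weights k) T \<longleftrightarrow>
    (\<exists>U. back_free U \<and> (\<forall>i d. leaf_count U i d = extremal_leaf_count k i d) \<and> T = reject_zero U)"
  using extremal_weights_pos[OF assms] optimal_ddg_extremal_iff[OF assms]
  by (auto simp: is_FLDR_def extremal_weights_def)

section \<open>Statistics of the extremal trees\<close>

lemma sum_inverse_powers_from_2:
  "(\<Sum>d\<le>Suc m. real (of_bool (2 \<le> d)) / 2 ^ d) = 1 / 2 - 1 / 2 ^ Suc m"
  by (induction m) (auto simp: field_simps)

lemma sum_weighted_inverse_powers_from_2:
  "(\<Sum>d\<le>Suc m. real d * real (of_bool (2 \<le> d)) / 2 ^ d) = 3 / 2 - (real m + 3) / 2 ^ Suc m"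
proof (induction m)
  case (Suc m)
  show ?case by (subst sum.atMost_Suc, subst Suc) (simp add: field_simps)
qed simp

text \<open>Every quantity is a function of the leaf counts, so the arrangement of the leaves does
  not matter.\<close>

lemma extremal_tree:
  assumes "k \<ge> 2" "back_free U" "\<And>i d. leaf_count U i d = extremal_leaf_count k i d"
  defines "y \<equiv> 2 / 2 ^ k"
  shows "depth U = k" "leaf_prob 0 U = (1 - y) / 2" "leaf_prob 1 U = (1 - y) / 2" "leaf_prob 2 U = y"
    "mean_depth U = 3 - 3 * y" "has_label U i \<Longrightarrow> i \<in> {0, 1, 2}"
proof -
  obtain m where k: "k = Suc m" using assms by (cases k) auto
  obtain i where "leaf_count U i (depth U) > 0" using back_free_leaf_at_depth[OF assms(2)] by blast
  then have "depth U \<le> k" by (auto simp: assms(3) extremal_leaf_count_def split: if_splits)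
  \<comment> \<open>Label 0 has a leaf at depth \<open>k\<close>, so the tree is no
    shallower.\<close>
  moreover have "\<not> depth U < k"
    using leaf_count_eq_0_beyond_depth[of U k 0] assms(1)
    by (auto simp: assms(3) extremal_leaf_count_def)
  ultimately show d: "depth U = k" by simp
  show lab: "i \<in> {0, 1, 2}" if "has_label U i" for i
    using that by (auto simp: has_label_def assms(3) extremal_leaf_count_def split: if_splits)
  note lp = leaf_prob_eq_sum[of U k, unfolded d, OF order_refl]
  note md = mean_depth_eq_sum[OF assms(2), of "{0, 1, 2}" k, unfolded d, OF _ lab order_refl]
  have lc01: "extremal_leaf_count k i d = of_bool (2 \<le> d)" if "i < 2" "d \<le> k" for i d
    using that by (simp add: extremal_leaf_count_def)
  have "leaf_prob i U = (1 - y) / 2" if "i < 2" for i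
  proof -
    have "leaf_prob i U = (\<Sum>d\<le>Suc m. real (of_bool (2 \<le> d)) / 2 ^ d)"
      unfolding lp assms(3) k by (intro sum.cong refl) (simp add: lc01[unfolded k] that)
    then show ?thesis
      unfolding sum_inverse_powers_from_2 by (simp add: y_def k)
  qed
  then show "leaf_prob 0 U = (1 - y) / 2" "leaf_prob 1 U = (1 - y) / 2" by simp_all
  have lc2: "real (extremal_leaf_count k 2 d) = (if d = m then 1 else 0)" for d
    by (simp add: extremal_leaf_count_def k)
  have *: "f d * real (extremal_leaf_count k 2 d) / 2 ^ d = (if d = m then f m / 2 ^ m else 0)"
    for f :: "nat \<Rightarrow> real" and d by (simp add: lc2)
  show "leaf_prob 2 U = y"
    unfolding lp assms(3) using *[of "\<lambda>_. 1"] by (simp add: k y_def)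
  have m01: "(\<Sum>d\<le>k. real d * real (leaf_count U i d) / 2 ^ d) = 3 / 2 - (real m + 3) / 2 ^ Suc m"
    if "i < 2" for i
    unfolding assms(3) k sum_weighted_inverse_powers_from_2[symmetric]
    by (intro sum.cong refl) (simp add: lc01[unfolded k] that)
  have m2: "(\<Sum>d\<le>k. real d * real (leaf_count U 2 d) / 2 ^ d) = real m / 2 ^ m"
    unfolding assms(3) * by (simp add: k)
  \<comment> \<open>With \<open>y = 1 / 2 ^ m\<close> the three labels add up to
    \<open>3 - (m + 3) * y + m * y\<close>: the terms linear in \<open>m\<close> cancel.\<close>
  show "mean_depth U = 3 - 3 * y"
    by (subst md) (simp_all add: m01 m2[simplified], simp_all add: y_def k field_simps)
qed

section \<open>The toll and its distance from 6\<close>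

lemma toll_extremal:
  assumes "k \<ge> 2" "is_FLDR_of (extremal_dist k) T"
  defines "y \<equiv> 2 / 2 ^ k"
  defines "p \<equiv> (1 - y) / (1 + y)" and "q \<equiv> 2 * y / (1 + y)"
  shows "depth T = k" "toll T = 6 * p + (p * log 2 p + q * log 2 q)"
proof -
  obtain U where U: "back_free U" "\<And>i d. leaf_count U i d = extremal_leaf_count k i d"
    and T: "T = reject_zero U"
    using assms by (auto simp: is_FLDR_of_extremal_iff is_FLDR_extremal_iff)
  note U' = extremal_tree[OF assms(1) U, folded y_def]
  show "depth T = k" by (simp add: T U')
  then have nb: "T \<noteq> Back" using assms(1) by auto
  have y: "y > 0" by (simp add: y_def)
  have b: "back_prob T = (1 - y) / 2" using U' by (simp add: T back_prob_reject_zero U)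
  then have b1: "back_prob T < 1" and b2: "1 - back_prob T = (1 + y) / 2"
    using y by (auto simp: field_simps)
  have l: "leaf_prob 1 T = (1 - y) / 2" "leaf_prob 2 T = y"
    using U' by (simp_all add: T leaf_prob_reject_zero)
  have "expected_cost T = 6 * p"
    unfolding expected_cost_eq[OF nb b1] b2 using U' y by (simp add: T p_def field_simps)
  moreover have "output_entropy T = - (p * log 2 p + q * log 2 q)"
  proof -
    have "leaf_prob 1 T / (1 - back_prob T) = p" "leaf_prob 2 T / (1 - back_prob T) = q"
      unfolding l b2 p_def q_def using y by (simp_all add: field_simps)
    \<comment> \<open>Label 0 has become back edges, so labels 1 and 2 carry the whole accepted mass
      \<open>(1 + y) / 2\<close>.\<close>
    moreover have "output_entropy T =
       - (\<Sum>i\<in>{1, 2}. let p = leaf_prob i T / (1 - back_prob T) in p * log 2 p)"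
      using nb b1 U'(6) l b by (intro output_entropy_eq) (auto simp: T field_simps)
    ultimately show ?thesis
      by (simp add: Let_def del: times_divide_eq_left One_nat_def)
  qed
  ultimately show "toll T = 6 * p + (p * log 2 p + q * log 2 q)" by (simp add: toll_def)
qed

text \<open>The gap is \<open>6 * q\<close> plus the entropy of \<open>(p, q)\<close>, hence
  nonnegative, so bounding it from above also bounds its absolute value.\<close>

lemma toll_extremal_bounds:
  assumes "k \<ge> 2" "is_FLDR_of (extremal_dist k) T"
  shows "0 \<le> 6 - toll T" "6 - toll T \<le> 36 * (real k * 2 powr (- real k))"
proof -
  define y :: real where "y = 2 / 2 ^ k"
  define p q where "p = (1 - y) / (1 + y)" and "q = 2 * y / (1 + y)"
  obtain m where k: "k = Suc m" "m \<ge> 1" using assms by (cases k) auto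
  have y2: "y = 1 / 2 ^ m" by (simp add: y_def k)
  have "(2::real) ^ 1 \<le> 2 ^ m" using k(2) by (rule power_increasing) simp
  then have y: "0 < y" "y \<le> 1 / 2" by (auto simp: y2 field_simps)
  have p: "0 < p" "p \<le> 1" and q: "0 < q" "q \<le> 1" "q \<le> 2 * y" "y \<le> q" and pq: "p = 1 - q"
    using y by (auto simp: p_def q_def field_simps)
  have toll: "6 - toll T = 6 * q - p * log 2 p - q * log 2 q"
    using toll_extremal(2)[OF assms, folded y_def, folded p_def q_def] by (simp add: pq)
  have "p * log 2 p \<le> 0" "q * log 2 q \<le> 0"
    using p q by (auto simp: mult_le_0_iff)
  with toll q show "0 \<le> 6 - toll T" by simp
  \<comment> \<open>From \<open>ln x \<le> x - 1\<close> at \<open>x = 1 / p\<close> one gets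
    \<open>- p * ln p \<le> 1 - p = q\<close>. The factor 2 bounds \<open>1 / ln 2\<close>.\<close>
  have "- (p * log 2 p) \<le> 2 * q"
  proof -
    have "ln (1 / p) \<le> 1 / p - 1" using p by (intro ln_le_minus_one) simp
    then have "p * - ln p \<le> p * (1 / p - 1)" using p by (intro mult_left_mono) (auto simp: ln_div)
    then have "- (p * ln p) \<le> q" using p by (simp add: pq field_simps)
    moreover have "1 / ln 2 \<le> (2::real)" using ln2_ge_two_thirds by (simp add: field_simps)
    ultimately have "- (p * ln p) * (1 / ln 2) \<le> q * 2"
      using q by (intro mult_mono) auto
    then show ?thesis by (simp add: log_def)
  qed
  \<comment> \<open>Here \<open>q \<ge> y = 1 / 2 ^ m\<close> bounds the logarithm and
    \<open>q \<le> 2 * y\<close> the factor in front. This term is the source of the factor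
    \<open>k\<close> in the rate.\<close>
  moreover have "- (q * log 2 q) \<le> 2 * y * real m"
  proof -
    have "log 2 y \<le> log 2 q" using y q by simp
    moreover have "log 2 y = - real m" by (simp add: y2 log_divide log_nat_power)
    ultimately have "- log 2 q \<le> real m" by simp
    then have "q * - log 2 q \<le> (2 * y) * real m" using q y by (intro mult_mono') auto
    then show ?thesis by simp
  qed
  \<comment> \<open>The first two terms give \<open>6 * q + 2 * q \<le> 16 * y\<close>. Next,
    \<open>1 \<le> k\<close> and \<open>m \<le> k\<close> yield \<open>18 * y * k\<close>, and
    \<open>y = 2 / 2 ^ k\<close> turns 18 into 36.\<close>
  ultimately have "6 - toll T \<le> 16 * y + 2 * y * real m" using toll q by simp
  also have "\<dots> \<le> 18 * y * real k" using y by (simp add: k algebra_simps)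
  also have "\<dots> = 36 * (real k * 2 powr (- real k))"
    by (simp add: y_def powr_minus powr_realpow field_simps)
  finally show "6 - toll T \<le> 36 * (real k * 2 powr (- real k))" .
qed

theorem theorem3p4:
  shows "\<exists>P :: nat \<Rightarrow> real list.
    (\<forall>k \<ge> 2. rational_distribution (P k) \<and> (\<exists>T. is_FLDR_of (P k) T)) \<and>
    (\<forall>T :: nat \<Rightarrow> ddg. (\<forall>k \<ge> 2. is_FLDR_of (P k) (T k)) \<longrightarrow>
       (\<forall>k \<ge> 2. depth (T k) = k) \<and>
       (\<lambda>k. 6 - toll (T k)) \<in> O(\<lambda>k. real k * 2 powr (- real k)))"
proof (intro exI[of _ extremal_dist] conjI allI impI)
  fix k :: nat assume k: "k \<ge> 2"
  show "rational_distribution (extremal_dist k)" by (rule rational_distribution_extremal[OF k])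
  show "\<exists>T. is_FLDR_of (extremal_dist k) T"
    using ex_optimal_ddg_extremal[OF k]
    by (auto simp: is_FLDR_of_extremal_iff is_FLDR_extremal_iff optimal_ddg_extremal_iff k)
next
  fix T :: "nat \<Rightarrow> ddg" and k :: nat
  assume "\<forall>k\<ge>2. is_FLDR_of (extremal_dist k) (T k)" "k \<ge> 2"
  then show "depth (T k) = k" using toll_extremal(1) by blast
next
  fix T :: "nat \<Rightarrow> ddg"
  assume T: "\<forall>k\<ge>2. is_FLDR_of (extremal_dist k) (T k)"
  show "(\<lambda>k. 6 - toll (T k)) \<in> O(\<lambda>k. real k * 2 powr (- real k))"
  \<comment> \<open>\<open>T k\<close> is unconstrained for \<open>k < 2\<close>, so the estimate is
    made from 2 onwards.\<close>
  proof (rule bigoI[where c = 36], rule eventually_mono[OF eventually_ge_at_top[of 2]])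
    fix k :: nat assume "k \<ge> 2"
    then show "norm (6 - toll (T k)) \<le> 36 * norm (real k * 2 powr (- real k))"
      using toll_extremal_bounds[of k "T k"] T by simp
  qed
qed

end
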